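(* Let $a_0,a_1,\alpha,\beta,u,v\in\mathbb{R}$ with $\alpha\beta\neq 0$, $uv\neq 0$ and $|a_0|+|a_1|\neq 0$, and let $(a_{n,k})_{0\le k\le n}$ be the binary binomial interpolated triangle with parameters $(a_0,a_1,\alpha,\beta;u,v)$. Let $s_n=\sum_{k=0}^{n}a_{n,k}$ be the sum of the entries of row $n$. Then the sequence $(s_n)_{n\ge 0}$ satisfies the fourth order linear homogeneous recurrence $$s_{n} = (\alpha+\mathcal{A})s_{n-1}+(\beta-\alpha \mathcal{A}+\mathcal{B})s_{n-2}-(\alpha \mathcal{B}+\beta \mathcal{A})s_{n-3}-\beta \mathcal{B}\, s_{n-4}\qquad\text{for all } n\ge 4,$$ where $\mathcal{A}=u\alpha+2v$ and $\mathcal{B}=u^2\beta-uv\alpha-v^2$.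
   Context: The binary binomial interpolated triangle with parameters $(a_0,a_1,\alpha,\beta;u,v)$ is the array of real numbers $a_{n,k}$ ($0\le k\le n$) defined as follows. Its left diagonal is $a_{n,0}=a_n$, where $(a_n)_{n\ge0}$ has initial values $a_0,a_1$ and satisfies $a_n=\alpha a_{n-1}+\beta a_{n-2}$ for $n\ge 2$. The other entries are given by $a_{n,k}=u\,a_{n,k-1}+v\,a_{n-1,k-1}$ for $1\le k\le n$. *)

theory Defs
  imports Complex_Main
begin

fun left_diag :: "real \<Rightarrow> real \<Rightarrow> real \<Rightarrow> real \<Rightarrow> nat \<Rightarrow> real" where
  "left_diag a0 a1 \<alpha> \<beta> 0 = a0"
| "left_diag a0 a1 \<alpha> \<beta> (Suc 0) = a1"
| "left_diag a0 a1 \<alpha> \<beta> (Suc (Suc n)) =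
     \<alpha> * left_diag a0 a1 \<alpha> \<beta> (Suc n) + \<beta> * left_diag a0 a1 \<alpha> \<beta> n"

text \<open>
  Only the entries in row \<open>n\<close> and position \<open>k\<close> with \<open>k \<le> n\<close> belong to the triangle.
  The second equation gives the function a dummy value outside this range; entries inside
  the range never depend on it.
\<close>

fun binomial_triangle ::
  "real \<Rightarrow> real \<Rightarrow> real \<Rightarrow> real \<Rightarrow> real \<Rightarrow> real \<Rightarrow> nat \<Rightarrow> nat \<Rightarrow> real" where
  "binomial_triangle a0 a1 \<alpha> \<beta> u v n 0 = left_diag a0 a1 \<alpha> \<beta> n"
| "binomial_triangle a0 a1 \<alpha> \<beta> u v 0 (Suc k) = 0"
| "binomial_triangle a0 a1 \<alpha> \<beta> u v (Suc n) (Suc k) =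
     u * binomial_triangle a0 a1 \<alpha> \<beta> u v (Suc n) k + v * binomial_triangle a0 a1 \<alpha> \<beta> u v n k"

definition row_sum ::
  "real \<Rightarrow> real \<Rightarrow> real \<Rightarrow> real \<Rightarrow> real \<Rightarrow> real \<Rightarrow> nat \<Rightarrow> real" where
  "row_sum a0 a1 \<alpha> \<beta> u v n = (\<Sum>k=0..n. binomial_triangle a0 a1 \<alpha> \<beta> u v n k)"

end

theory Submission
  imports Defs
begin

text \<open>
  If \<open>x\<close> is a root of \<open>t\<^sup>2 - \<alpha> t - \<beta>\<close>, then \<open>u x + v\<close> is a root of \<open>t\<^sup>2 - A t - B\<close>. Accordingly
  every column of the triangle satisfies the \<open>(\<alpha>, \<beta>)\<close>-recurrence and every falling diagonal the
  \<open>(A, B)\<close>-recurrence. Summing the column recurrences shows that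
  \<open>s (n + 2) - \<alpha> s (n + 1) - \<beta> s n\<close> is a combination of entries of two falling diagonals, so
  the operator with characteristic polynomial \<open>(t\<^sup>2 - \<alpha> t - \<beta>) (t\<^sup>2 - A t - B)\<close> annihilates \<open>s\<close>.
\<close>

context
  fixes a0 a1 \<alpha> \<beta> u v :: real
begin

private abbreviation (input) T :: "nat \<Rightarrow> nat \<Rightarrow> real" where
  "T \<equiv> binomial_triangle a0 a1 \<alpha> \<beta> u v"

private abbreviation (input) S :: "nat \<Rightarrow> real" where
  "S \<equiv> row_sum a0 a1 \<alpha> \<beta> u v"

text \<open>Each column is a fixed linear combination of the previous column and its shift, so the
  recurrence passes on from the left diagonal. The bound keeps dummy zeros out.\<close>

lemma column_recurrence:
  "k \<le> n \<Longrightarrow> T (Suc (Suc n)) k = \<alpha> * T (Suc n) k + \<beta> * T n k"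
proof (induction k arbitrary: n)
  case 0
  then show ?case by simp
next
  case (Suc k)
  then obtain m where m: "n = Suc m" "k \<le> m"
    by (cases n) auto
  show ?case
    using Suc.IH[of m] Suc.IH[of n] m by (simp add: algebra_simps)
qed

text \<open>A falling diagonal has constant row minus position, here \<open>j\<close>. Only the base
  case uses the recurrence of \<open>left_diag\<close>; the inductive step would work for any two
  coefficients.\<close>

lemma diagonal_recurrence:
  "T (Suc (Suc (j + k))) (Suc (Suc k)) =
     (u * \<alpha> + 2 * v) * T (Suc (j + k)) (Suc k)
     + (u^2 * \<beta> - u * v * \<alpha> - v^2) * T (j + k) k"
proof (induction k arbitrary: j)
  case 0
  then show ?case by (simp add: power2_eq_square algebra_simps)
next
  case (Suc k)
  let ?A = "u * \<alpha> + 2 * v" and ?B = "u^2 * \<beta> - u * v * \<alpha> - v^2"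
  \<comment> \<open>Diagonal \<open>j\<close>, shifted by one, combines diagonals
    \<open>Suc j\<close> and \<open>j\<close>; hence the induction needs \<open>j\<close>
    arbitrary.\<close>
  have step: "T (Suc (j + i)) (Suc i) = u * T (Suc j + i) i + v * T (j + i) i" for i
    by simp
  have "T (Suc (Suc (j + Suc k))) (Suc (Suc (Suc k))) =
      u * T (Suc (Suc (Suc j + k))) (Suc (Suc k)) + v * T (Suc (Suc (j + k))) (Suc (Suc k))"
    using step[of "Suc (Suc k)"] by (simp del: binomial_triangle.simps)
  also have "\<dots> = u * (?A * T (Suc (Suc j + k)) (Suc k) + ?B * T (Suc j + k) k)
      + v * (?A * T (Suc (j + k)) (Suc k) + ?B * T (j + k) k)"
    by (simp only: Suc.IH)
  also have "\<dots> = ?A * (u * T (Suc (Suc j + k)) (Suc k) + v * T (Suc (j + k)) (Suc k))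
      + ?B * (u * T (Suc j + k) k + v * T (j + k) k)"
    by algebra
  also have "\<dots> = ?A * T (Suc (j + Suc k)) (Suc (Suc k)) + ?B * T (j + Suc k) (Suc k)"
    using step[of k] step[of "Suc k"] by (simp del: binomial_triangle.simps)
  finally show ?case .
qed

text \<open>Columns \<open>0..n\<close> meet all three rows and cancel by
  \<open>column_recurrence\<close>; only the ends of the two longer rows remain.\<close>

lemma row_sum_recurrence_defect:
  "S (Suc (Suc n)) - \<alpha> * S (Suc n) - \<beta> * S n =
     T (Suc (Suc n)) (Suc (Suc n)) + T (Suc (Suc n)) (Suc n) - \<alpha> * T (Suc n) (Suc n)"
proof -
  have "(\<Sum>k=0..n. T (Suc (Suc n)) k) = (\<Sum>k=0..n. \<alpha> * T (Suc n) k + \<beta> * T n k)"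
    by (intro sum.cong) (auto simp: column_recurrence simp del: binomial_triangle.simps)
  then show ?thesis
    by (simp add: row_sum_def sum.distrib sum_distrib_left[symmetric] algebra_simps
        del: binomial_triangle.simps)
qed

lemma row_sum_recurrence:
  defines "A \<equiv> u * \<alpha> + 2 * v"
    and "B \<equiv> u^2 * \<beta> - u * v * \<alpha> - v^2"
  shows "S (n + 4) = (\<alpha> + A) * S (n + 3) + (\<beta> - \<alpha> * A + B) * S (n + 2)
    - (\<alpha> * B + \<beta> * A) * S (n + 1) - \<beta> * B * S n"
proof -
  define c where "c n = S (Suc (Suc n)) - \<alpha> * S (Suc n) - \<beta> * S n" for n
  have "c (Suc (Suc n)) = A * c (Suc n) + B * c n"
    \<comment> \<open>One instance for each of the three entries in the defect of row
      \<open>n + 4\<close>, on diagonals 0, 1 and 0.\<close>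
    using diagonal_recurrence[of 0 "Suc (Suc n)"] diagonal_recurrence[of 1 "Suc n"]
      diagonal_recurrence[of 0 "Suc n"]
    unfolding c_def row_sum_recurrence_defect A_def[symmetric] B_def[symmetric]
    by (simp add: algebra_simps del: binomial_triangle.simps)
  then show ?thesis
    by (simp add: c_def eval_nat_numeral algebra_simps)
qed

end

theorem theorem5:
  fixes a0 a1 \<alpha> \<beta> u v :: real
  assumes "\<alpha> * \<beta> \<noteq> 0"
    and "u * v \<noteq> 0"
    and "\<bar>a0\<bar> + \<bar>a1\<bar> \<noteq> 0"
  shows "let s = row_sum a0 a1 \<alpha> \<beta> u v;
             A = u * \<alpha> + 2 * v;
             B = u^2 * \<beta> - u * v * \<alpha> - v^2
         in \<forall>n\<ge>4. s n = (\<alpha> + A) * s (n - 1) + (\<beta> - \<alpha> * A + B) * s (n - 2)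
                       - (\<alpha> * B + \<beta> * A) * s (n - 3) - \<beta> * B * s (n - 4)"
  unfolding Let_def
proof (intro allI impI)
  fix n :: nat
  assume "4 \<le> n"
  then obtain m where m: "n = m + 4"
    by (metis add.commute le_iff_add)
  have shifts: "n - 1 = m + 3" "n - 2 = m + 2" "n - 3 = m + 1" "n - 4 = m"
    using m by simp_all
  show "row_sum a0 a1 \<alpha> \<beta> u v n =
      (\<alpha> + (u * \<alpha> + 2 * v)) * row_sum a0 a1 \<alpha> \<beta> u v (n - 1)
      + (\<beta> - \<alpha> * (u * \<alpha> + 2 * v) + (u^2 * \<beta> - u * v * \<alpha> - v^2)) * row_sum a0 a1 \<alpha> \<beta> u v (n - 2)
      - (\<alpha> * (u^2 * \<beta> - u * v * \<alpha> - v^2) + \<beta> * (u * \<alpha> + 2 * v)) * row_sum a0 a1 \<alpha> \<beta> u v (n - 3)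
      - \<beta> * (u^2 * \<beta> - u * v * \<alpha> - v^2) * row_sum a0 a1 \<alpha> \<beta> u v (n - 4)"
    unfolding shifts unfolding m by (rule row_sum_recurrence)
qed

end
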